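(* Let $1\le k\le n-1$. A point $L\in G_{n,k}$ is a regular point of the moment map $\mu:G_{n,k}\to\mathbb{R}^n$ (i.e. the differential $d\mu(L)$ has the maximal possible rank $n-1$) if and only if its stationary subgroup $\mathbb{C}^*_L$ for the effective action of the torus $(\mathbb{C}^* )^{n-1}=(\mathbb{C}^* )^n/\mathrm{diag}(\mathbb{C}^* )$ is trivial.
   Context: $G_{n,k}$ is the Grassmann manifold of $k$-dimensional complex subspaces of $\mathbb{C}^n$ with the action of $(\mathbb{C}^* )^n$ induced by the coordinatewise action on $\mathbb{C}^n$; the diagonal subgroup acts trivially, giving an effective action of $(\mathbb{C}^* )^{n}/\mathrm{diag}(\mathbb{C}^* )\cong(\mathbb{C}^* )^{n-1}$. $P^I(L)$, $|I|=k$, are the Pl\"ucker coordinates, $\Lambda_I\in\mathbb{R}^n$ is the $0/1$ indicator vector of $I\subset\{1,\dots,n\}$, and $\mu(L)=\frac{1}{\sum_I|P^I(L)|^2}\sum_I|P^I(L)|^2\Lambda_I$. The image of $\mu$ is the hypersimplex $\Delta_{n,k}=\{x\in[0,1]^n:\sum x_i=k\}$, which has dimension $n-1$ and lies in the hyperplane $\sum x_i=k$, so $\mu$ has rank at most $n-1$. *)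

theory Defs
  imports
    "HOL-Analysis.Analysis"
    "HOL-Algebra.Group_Action"
    "Jordan_Normal_Form.Determinant"
begin

no_notation Matrix.vec_index (infixl "$" 100)

text \<open>The index set \<open>{1, \<dots>, n}\<close> is the finite linearly ordered type \<open>'n\<close>; thus \<open>\<complex>\<^sup>n\<close> is
  \<^typ>\<open>complex ^ 'n\<close> and \<open>n = CARD('n)\<close>. The prefix \<open>vec\<close> refers to complex linear algebra.\<close>

definition grassmannian :: "nat \<Rightarrow> (complex ^ 'n::finite) set set" where
  "grassmannian k = {L. vec.subspace L \<and> vec.dim L = k}"

definition basis_list :: "(complex ^ 'n::finite) set \<Rightarrow> (complex ^ 'n) list \<Rightarrow> bool" where
  "basis_list L bs \<longleftrightarrow> distinct bs \<and> vec.independent (set bs) \<and> vec.span (set bs) = L"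

text \<open>The Pluecker coordinate \<open>P\<^sup>I\<close>: the maximal minor with rows \<open>I\<close> (in increasing order) of the
  \<open>n \<times> k\<close> matrix with columns \<open>bs\<close>. It is meaningful for \<open>card I = length bs\<close>.\<close>

definition pluecker ::
  "(complex ^ 'n::{finite,linorder}) list \<Rightarrow> 'n set \<Rightarrow> complex" where
  "pluecker bs I =
     Determinant.det (Matrix.mat (length bs) (length bs)
       (\<lambda>(i, j). (bs ! j) $ (sorted_list_of_set I ! i)))"

definition indicator_vec :: "'n set \<Rightarrow> real ^ 'n::finite" where
  "indicator_vec I = (\<chi> i. if i \<in> I then 1 else 0)"

definition moment_map_of_basis ::
  "(complex ^ 'n::{finite,linorder}) list \<Rightarrow> real ^ 'n::{finite,linorder}" where
  "moment_map_of_basis bs =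
     (1 / (\<Sum>I | card I = length bs. (cmod (pluecker bs I))\<^sup>2)) *\<^sub>R
     (\<Sum>I | card I = length bs. (cmod (pluecker bs I))\<^sup>2 *\<^sub>R indicator_vec I)"

text \<open>Pluecker coordinates are defined up to a common nonzero factor, which cancels here; see
  \<open>moment_map_eq\<close> below for the independence of the basis.\<close>

definition moment_map :: "(complex ^ 'n::{finite,linorder}) set \<Rightarrow> real ^ 'n::{finite,linorder}" where
  "moment_map L = moment_map_of_basis (SOME bs. basis_list L bs)"

lemma pluecker_change_basis:
  fixes bs cs :: "(complex ^ 'n::{finite,linorder}) list"
  assumes "basis_list L bs" "basis_list L cs"
  shows "\<exists>d. \<forall>I. pluecker cs I = d * pluecker bs I"
proof -
  let ?k = "length bs"
  have len: "length cs = ?k"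
    using assms unfolding basis_list_def
    by (metis distinct_card vec.dim_eq_card_independent vec.dim_span)
  have "\<exists>g. cs ! j = (\<Sum>l<?k. g l *s bs ! l)" if "j < ?k" for j
  proof -
    have "cs ! j \<in> vec.span (set bs)"
      using assms that len unfolding basis_list_def by (metis nth_mem vec.span_base)
    then obtain u where u: "cs ! j = (\<Sum>v\<in>set bs. u v *s v)"
      using vec.span_finite[of "set bs"] by auto
    have "bij_betw ((!) bs) {..<?k} (set bs)"
      using assms(1) by (simp add: basis_list_def bij_betw_nth)
    then have "cs ! j = (\<Sum>l<?k. u (bs ! l) *s bs ! l)"
      unfolding u by (rule sum.reindex_bij_betw[symmetric])
    then show ?thesis by (intro exI[of _ "\<lambda>l. u (bs ! l)"])
  qed
  then obtain g where g: "\<And>j. j < ?k \<Longrightarrow> cs ! j = (\<Sum>l<?k. g j l *s bs ! l)"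
    by metis
  let ?G = "Matrix.mat ?k ?k (\<lambda>(l, j). g j l)"
  have "pluecker cs I = Determinant.det ?G * pluecker bs I" for I
  proof -
    let ?s = "sorted_list_of_set I"
    let ?A = "Matrix.mat ?k ?k (\<lambda>(i, j). (bs ! j) $ (?s ! i))"
    have "Matrix.mat ?k ?k (\<lambda>(i, j). (cs ! j) $ (?s ! i)) = ?A * ?G"
      by (rule eq_matI)
        (auto simp: g scalar_prod_def atLeast0LessThan mult.commute intro!: sum.cong)
    then have "pluecker cs I = Determinant.det (?A * ?G)"
      by (simp add: pluecker_def len)
    also have "\<dots> = Determinant.det ?A * Determinant.det ?G"
      by (rule Determinant.det_mult) auto
    finally show ?thesis by (simp add: pluecker_def)
  qed
  then show ?thesis by blast
qed

lemma moment_map_eq: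
  assumes "basis_list L bs"
  shows "moment_map L = moment_map_of_basis bs"
proof -
  define cs where "cs = (SOME cs. basis_list L cs)"
  have cs: "basis_list L cs"
    unfolding cs_def using assms by (rule someI)
  have len: "length cs = length bs"
    using assms cs unfolding basis_list_def
    by (metis distinct_card vec.dim_eq_card_independent vec.dim_span)
  obtain c d where d: "\<And>I. pluecker cs I = d * pluecker bs I"
    and c: "\<And>I. pluecker bs I = c * pluecker cs I"
    using pluecker_change_basis[OF assms cs] pluecker_change_basis[OF cs assms] by metis
  have "moment_map_of_basis cs = moment_map_of_basis bs"
  proof (cases "d = 0")
    case True
    then have "pluecker cs I = 0" "pluecker bs I = 0" for I
      using c[of I] d[of I] by auto
    then show ?thesis by (simp add: moment_map_of_basis_def)
  next
    case False
    then show ?thesis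
      by (simp add: moment_map_of_basis_def len d norm_mult power_mult_distrib
          flip: sum_distrib_left scaleR_scaleR scaleR_sum_right)
        (simp add: divide_simps)
  qed
  then show ?thesis by (simp add: moment_map_def cs_def)
qed


text \<open>The standard affine atlas. For \<open>card J = k\<close> the chart \<open>{L. P\<^sup>J(L) \<noteq> 0}\<close> consists of the \<open>L\<close>
  that are column spaces of a matrix whose rows in \<open>J\<close> form the identity matrix; its
  coordinates are the remaining entries \<open>X $ i $ j\<close> with \<open>i \<notin> J\<close>, where the columns are indexed
  by \<open>j \<in> J\<close>. This space \<open>\<complex>\<^bsup>k(n-k)\<^esup>\<close> of coordinates is embedded in the \<open>n \<times> n\<close> matrices
  (extension by zero).\<close>

definition chart_coords :: "'n set \<Rightarrow> (complex ^ 'n ^ 'n::finite) set" where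
  "chart_coords J = {X. \<forall>i j. X $ i $ j \<noteq> 0 \<longrightarrow> i \<notin> J \<and> j \<in> J}"

definition chart_param :: "'n set \<Rightarrow> complex ^ 'n ^ 'n \<Rightarrow> (complex ^ 'n::finite) set" where
  "chart_param J X = vec.span ((\<lambda>j. axis j 1 + (\<chi> i. X $ i $ j)) ` J)"

text \<open>The differential at \<open>L\<close> of a map \<open>f\<close> on the Grassmannian, read in a chart around \<open>L\<close>, exists
  and has real rank \<open>r\<close>. Charts being compatible, it does not matter which chart is used. The
  derivative within the subspace \<open>chart_coords J\<close> is determined by \<open>f\<close> on that subspace only, so
  the rank is the dimension of the image of the subspace.\<close>

definition has_differential_rank ::
  "nat \<Rightarrow> ((complex ^ 'n) set \<Rightarrow> real ^ 'n) \<Rightarrow> (complex ^ 'n::finite) set \<Rightarrow> nat \<Rightarrow> bool" where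
  "has_differential_rank k f L r \<longleftrightarrow>
     (\<exists>J X D. card J = k \<and> X \<in> chart_coords J \<and> chart_param J X = L \<and>
        ((\<lambda>Y. f (chart_param J Y)) has_derivative D) (at X within chart_coords J) \<and>
        dim (D ` chart_coords J) = r)"

definition regular_point :: "nat \<Rightarrow> (complex ^ 'n::{finite,linorder}) set \<Rightarrow> bool" where
  "regular_point k L \<longleftrightarrow> has_differential_rank k moment_map L (CARD('n) - 1)"


definition torus :: "(complex ^ 'n::finite) monoid" where
  "torus = \<lparr>carrier = {t. \<forall>i. t $ i \<noteq> 0}, mult = (*), one = 1\<rparr>"

definition diagonal :: "(complex ^ 'n::finite) set" where
  "diagonal = {t. \<exists>c. c \<noteq> 0 \<and> t = (\<chi> i. c)}"

lemma comm_group_torus: "comm_group (torus :: (complex ^ 'n::finite) monoid)"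
proof (rule comm_groupI)
  fix x :: "complex ^ 'n"
  assume "x \<in> carrier torus"
  then have "(\<chi> i. inverse (x $ i)) \<in> carrier torus" "(\<chi> i. inverse (x $ i)) \<otimes>\<^bsub>torus\<^esub> x = \<one>\<^bsub>torus\<^esub>"
    by (auto simp: torus_def Finite_Cartesian_Product.vec_eq_iff)
  then show "\<exists>y\<in>carrier torus. y \<otimes>\<^bsub>torus\<^esub> x = \<one>\<^bsub>torus\<^esub>"
    by blast
qed (auto simp: torus_def mult_ac)

lemma diagonal_normal: "diagonal \<lhd> (torus :: (complex ^ 'n::finite) monoid)"
proof -
  interpret comm_group "torus :: (complex ^ 'n) monoid" by (rule comm_group_torus)
  have "subgroup diagonal (torus :: (complex ^ 'n) monoid)"
  proof (rule subgroupI)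
    fix a :: "complex ^ 'n"
    assume "a \<in> diagonal"
    then obtain c where c: "c \<noteq> 0" "a = (\<chi> i. c)" by (auto simp: diagonal_def)
    have "inv\<^bsub>torus\<^esub> a = (\<chi> i. inverse c)"
      by (rule inv_equality) (use c in \<open>auto simp: torus_def Finite_Cartesian_Product.vec_eq_iff\<close>)
    then show "inv\<^bsub>torus\<^esub> a \<in> diagonal"
      using c by (auto simp: diagonal_def intro!: exI[of _ "inverse c"])
  next
    show "(diagonal :: (complex ^ 'n) set) \<noteq> {}"
      by (auto simp: diagonal_def intro!: exI[of _ 1])
  next
    fix a b :: "complex ^ 'n"
    assume "a \<in> diagonal" "b \<in> diagonal"
    then obtain c d where "c \<noteq> 0" "a = (\<chi> i. c)" "d \<noteq> 0" "b = (\<chi> i. d)"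
      by (auto simp: diagonal_def)
    then show "a \<otimes>\<^bsub>torus\<^esub> b \<in> diagonal"
      by (auto simp: diagonal_def torus_def Finite_Cartesian_Product.vec_eq_iff intro!: exI[of _ "c * d"])
  qed (auto simp: diagonal_def torus_def)
  then show ?thesis by (simp add: normal_iff_subgroup)
qed

abbreviation effective_torus :: "(complex ^ 'n::finite) set monoid" where
  "effective_torus \<equiv> torus Mod diagonal"

text \<open>Multiplication on \<^typ>\<open>complex ^ 'n\<close> is componentwise.\<close>

definition torus_act :: "complex ^ 'n \<Rightarrow> (complex ^ 'n::finite) set \<Rightarrow> (complex ^ 'n) set" where
  "torus_act t L = (\<lambda>v. t * v) ` L"

text \<open>A coset acts through any of its elements.\<close>

definition effective_act ::
  "nat \<Rightarrow> (complex ^ 'n) set \<Rightarrow> (complex ^ 'n::finite) set \<Rightarrow> (complex ^ 'n) set" where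
  "effective_act k C = (\<lambda>L \<in> grassmannian k. the_elem ((\<lambda>t. torus_act t L) ` C))"

lemma torus_act_mult: "torus_act (s * t) L = torus_act s (torus_act t L)"
  by (simp add: torus_act_def image_image mult.assoc)

lemma torus_act_one: "torus_act 1 L = L"
  by (simp add: torus_act_def)

lemma torus_act_diagonal:
  assumes "d \<in> diagonal" "vec.subspace L"
  shows "torus_act d L = L"
proof -
  obtain c where c: "c \<noteq> 0" "d = (\<chi> i. c)" using assms by (auto simp: diagonal_def)
  have mult: "d * v = c *s v" for v by (simp add: c Finite_Cartesian_Product.vec_eq_iff)
  have "v \<in> (\<lambda>v. c *s v) ` L" if "v \<in> L" for v
    by (rule image_eqI[of _ _ "inverse c *s v"])
      (use that c assms in \<open>auto simp: vec.subspace_scale\<close>)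
  then show ?thesis
    using assms(2) by (auto simp: torus_act_def mult vec.subspace_scale)
qed

lemma torus_act_grassmannian:
  assumes "t \<in> carrier torus" "L \<in> grassmannian k"
  shows "torus_act t L \<in> grassmannian k"
proof -
  interpret t: Vector_Spaces.linear "(*s)" "(*s)" "(*) t"
    by unfold_locales (auto simp: Finite_Cartesian_Product.vec_eq_iff algebra_simps)
  have "inj ((*) t)"
    using assms(1) by (auto simp: inj_def torus_def Finite_Cartesian_Product.vec_eq_iff)
  then have "vec.dim ((*) t ` L) = vec.dim L"
    using vec.dim_image_eq[OF t.linear_axioms, of L] by (auto simp: inj_on_def)
  then show ?thesis
    using assms(2) t.subspace_image[of L] by (auto simp: grassmannian_def torus_act_def)
qed

lemma effective_act_coset:
  assumes "L \<in> grassmannian k"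
  shows "effective_act k (diagonal #>\<^bsub>torus\<^esub> t) L = torus_act t L"
proof -
  have 1: "torus_act (d * t) L = torus_act t L" if "d \<in> diagonal" for d
    using that assms by (metis grassmannian_def mem_Collect_eq mult.commute torus_act_diagonal torus_act_mult)
  have "(\<lambda>t. torus_act t L) ` (diagonal #>\<^bsub>torus\<^esub> t) = (\<lambda>d. torus_act (d * t) L) ` diagonal"
    by (auto simp: r_coset_def torus_def)
  also have "\<dots> = {torus_act t L}"
    using 1 by (auto simp: diagonal_def image_iff intro!: exI[of _ 1])
  finally show ?thesis using assms by (simp add: effective_act_def)
qed

lemma group_action_effective_act:
  "group_action effective_torus (grassmannian k :: (complex ^ 'n::finite) set set) (effective_act k)"
proof -
  let ?E = "grassmannian k :: (complex ^ 'n) set set"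
  interpret T: comm_group "torus :: (complex ^ 'n) monoid" by (rule comm_group_torus)
  interpret D: normal diagonal "torus :: (complex ^ 'n) monoid" by (rule diagonal_normal)
  have Bij: "effective_act k (diagonal #>\<^bsub>torus\<^esub> t) \<in> Bij ?E" if t: "t \<in> carrier torus" for t
  proof -
    let ?u = "inv\<^bsub>torus\<^esub> t"
    have u: "?u \<in> carrier torus" and u1: "?u * t = 1" "t * ?u = 1"
      using T.inv_closed[OF t] T.l_inv[OF t] T.r_inv[OF t] by (simp_all add: torus_def)
    have "bij_betw (torus_act t) ?E ?E"
      by (rule bij_betw_byWitness[where f' = "torus_act ?u"])
        (use t u u1 in \<open>auto simp: torus_act_grassmannian torus_act_one simp flip: torus_act_mult\<close>)
    moreover have "bij_betw (effective_act k (diagonal #>\<^bsub>torus\<^esub> t)) ?E ?E \<longleftrightarrow> bij_betw (torus_act t) ?E ?E"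
      by (rule bij_betw_cong) (rule effective_act_coset)
    ultimately show ?thesis by (simp add: Bij_def effective_act_def)
  qed
  have "group_hom effective_torus (BijGroup ?E) (effective_act k)"
  proof (intro group_hom.intro group_hom_axioms.intro homI)
    show "group (effective_torus :: (complex ^ 'n) set monoid)" by (rule D.factorgroup_is_group)
    show "group (BijGroup ?E)" by (rule group_BijGroup)
  next
    fix C :: "(complex ^ 'n) set"
    assume "C \<in> carrier effective_torus"
    then show "effective_act k C \<in> carrier (BijGroup ?E)"
      using Bij by (auto simp: carrier_FactGroup BijGroup_def)
  next
    fix C C' :: "(complex ^ 'n) set"
    assume "C \<in> carrier effective_torus" "C' \<in> carrier effective_torus"
    then obtain s t where s: "s \<in> carrier torus" "C = diagonal #>\<^bsub>torus\<^esub> s"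
      and t: "t \<in> carrier torus" "C' = diagonal #>\<^bsub>torus\<^esub> t"
      by (auto simp: carrier_FactGroup)
    have mult: "C \<otimes>\<^bsub>effective_torus\<^esub> C' = diagonal #>\<^bsub>torus\<^esub> (s * t)"
      using D.rcos_sum[OF s(1) t(1)] s t by (simp add: torus_def)
    have "effective_act k (C \<otimes>\<^bsub>effective_torus\<^esub> C') L = compose ?E (effective_act k C) (effective_act k C') L" for L
    proof (cases "L \<in> ?E")
      case True
      then show ?thesis
        unfolding mult using s t
        by (simp add: compose_def effective_act_coset torus_act_grassmannian torus_act_mult)
    qed (simp add: effective_act_def compose_def)
    then show "effective_act k (C \<otimes>\<^bsub>effective_torus\<^esub> C') =
        effective_act k C \<otimes>\<^bsub>BijGroup ?E\<^esub> effective_act k C'"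
      using Bij s t by (auto simp: BijGroup_def)
  qed
  then show ?thesis by (rule group_action.intro)
qed

end

(* Pairing the moment map with s in R^n gives the mean of s_I = sum_{i in I} s_i under the weights
   |P^I(L)|^2.
   Along the flow of exp(u s) the weights are multiplied by exp(2 u s_I), so the derivative of the
   mean is twice the variance of s_I. If s is orthogonal to the image, then s_I is constant on the
   I with P^I(L) <> 0, hence s_i = s_j for every nonzero chart entry X_ij of L, and exp(s) fixes L.
   Conversely, let t fix L and let S be a level set of t. In the chart, S is a union of blocks of X.
   Tangent directions respecting the blocks keep the pairing with the indicator of S constant, and
   the others are negated by an involution in the compact torus fixing L, so the differential kills
   them. Thus the rank is n - 1 iff only constant vectors s are orthogonal to the image, iff only
   the diagonal fixes L. *)

theory Submission
  imports Defs
begin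

section \<open>Chart bases and the equations of a subspace in a chart\<close>

text \<open>The columns come in the same increasing order in which \<open>pluecker\<close> lists the
  rows, so that the minor at \<open>J\<close> is exactly 1, with no sign.\<close>

definition chart_basis :: "'n::{finite,linorder} set \<Rightarrow> complex ^ 'n::{finite,linorder} ^ 'n::{finite,linorder} \<Rightarrow> (complex ^ 'n::{finite,linorder}) list" where
  "chart_basis J X = map (\<lambda>j. axis j 1 + (\<chi> i. X $ i $ j)) (sorted_list_of_set J)"

lemma length_chart_basis [simp]: "length (chart_basis J X) = card J"
  by (simp add: chart_basis_def)

lemma chart_vector_nth:
  assumes "X \<in> chart_coords J" "j \<in> J"
  shows "(axis j 1 + (\<chi> i. X $ i $ j)) $ i = (if i \<in> J then if i = j then 1 else 0 else X $ i $ j)"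
  using assms by (auto simp: chart_coords_def axis_def)

text \<open>The rows in \<open>J\<close> form the identity, so the coordinates \<open>v $ j\<close>
  with \<open>j \<in> J\<close> are themselves the coefficients of \<open>v\<close>. The subspace is
  thus the graph of a linear map, and membership can be tested row by row.\<close>

lemma mem_chart_param_iff:
  fixes X :: "complex ^ 'n ^ 'n::finite"
  assumes X: "X \<in> chart_coords J"
  shows "v \<in> chart_param J X \<longleftrightarrow> (\<forall>i. i \<notin> J \<longrightarrow> v $ i = (\<Sum>l\<in>J. X $ i $ l * v $ l))"
    (is "_ \<longleftrightarrow> ?P v")
proof
  let ?b = "\<lambda>j. axis j 1 + (\<chi> i. X $ i $ j)"
  have sub: "vec.subspace {v. ?P v}"
    by (auto simp: vec.subspace_def sum.distrib algebra_simps sum_distrib_left)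
  have "?b j \<in> {v. ?P v}" if "j \<in> J" for j
  proof -
    have "(\<Sum>l\<in>J. X $ i $ l * ?b j $ l) = (\<Sum>l\<in>J. if l = j then X $ i $ j else 0)" for i
      by (rule sum.cong) (auto simp: chart_vector_nth[OF X that] simp del: vector_add_component)
    then show ?thesis
      using that by (simp add: chart_vector_nth[OF X that] del: vector_add_component)
  qed
  then have "?b ` J \<subseteq> {v. ?P v}" by blast
  then have "chart_param J X \<subseteq> {v. ?P v}"
    unfolding chart_param_def by (intro vec.span_minimal sub)
  then show "v \<in> chart_param J X \<Longrightarrow> ?P v" by auto
next
  let ?b = "\<lambda>j. axis j 1 + (\<chi> i. X $ i $ j)"
  assume P: "?P v"
  have "v $ i = (\<Sum>j\<in>J. v $ j *s ?b j) $ i" for i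
  proof -
    have "(\<Sum>j\<in>J. v $ j *s ?b j) $ i = (\<Sum>j\<in>J. v $ j * ?b j $ i)"
      by (simp only: sum_component vector_smult_component)
    also have "\<dots> = (\<Sum>j\<in>J. if i \<in> J then (if j = i then v $ j else 0) else X $ i $ j * v $ j)"
      by (rule sum.cong) (auto simp: chart_vector_nth[OF X] simp del: vector_add_component)
    also have "\<dots> = v $ i"
    proof (cases "i \<in> J")
      case False
      then show ?thesis using P[rule_format, OF False] by simp
    qed simp
    finally show ?thesis by (rule sym)
  qed
  then have "v = (\<Sum>j\<in>J. v $ j *s ?b j)"
    unfolding Finite_Cartesian_Product.vec_eq_iff by (rule allI)
  also have "\<dots> \<in> chart_param J X"
    unfolding chart_param_def by (intro vec.span_sum vec.span_scale vec.span_base) auto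
  finally show "v \<in> chart_param J X" .
qed

lemma basis_list_chart_basis:
  fixes X :: "complex ^ 'n::{finite,linorder} ^ 'n::{finite,linorder}"
  assumes X: "X \<in> chart_coords J"
  shows "basis_list (chart_param J X) (chart_basis J X)"
proof -
  let ?b = "\<lambda>j. axis j 1 + (\<chi> i. X $ i $ j)"
  have inj: "inj_on ?b J"
  proof (rule inj_onI)
    fix i j assume "i \<in> J" "j \<in> J" "?b i = ?b j"
    then show "i = j"
      using chart_vector_nth[OF X \<open>i \<in> J\<close>, of i] chart_vector_nth[OF X \<open>j \<in> J\<close>, of i]
      by (auto split: if_splits)
  qed
  have "vec.independent (?b ` J)"
  proof (rule vec.independent_if_scalars_zero)
    fix f v assume s: "(\<Sum>x\<in>?b ` J. f x *s x) = 0" and "v \<in> ?b ` J"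
    then obtain j where j: "j \<in> J" "v = ?b j" by auto
    \<comment> \<open>Coordinate \<open>j\<close> of the relation sees only the vector with index
      \<open>j\<close>.\<close>
    have "0 = (\<Sum>l\<in>J. f (?b l) *s ?b l) $ j"
      using s by (simp add: sum.reindex[OF inj])
    also have "\<dots> = (\<Sum>l\<in>J. f (?b l) * ?b l $ j)"
      by (simp only: sum_component vector_smult_component)
    also have "\<dots> = (\<Sum>l\<in>J. if l = j then f (?b l) else 0)"
      by (rule sum.cong) (use j in \<open>auto simp: chart_vector_nth[OF X] simp del: vector_add_component\<close>)
    finally show "f v = 0" using j by simp
  qed simp
  then show ?thesis
    using inj by (auto simp: basis_list_def chart_basis_def chart_param_def distinct_map)
qed

lemma pluecker_chart_basis:
  fixes X :: "complex ^ 'n::{finite,linorder} ^ 'n::{finite,linorder}"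
  assumes X: "X \<in> chart_coords J"
  shows "pluecker (chart_basis J X) J = 1"
proof -
  let ?s = "sorted_list_of_set J"
  have "Matrix.mat (card J) (card J) (\<lambda>(i, j). (chart_basis J X ! j) $ (?s ! i)) = 1\<^sub>m (card J)"
  proof (rule eq_matI)
    fix i j assume ij: "i < dim_row (1\<^sub>m (card J) :: complex mat)" "j < dim_col (1\<^sub>m (card J) :: complex mat)"
    then have m: "?s ! i \<in> J" "?s ! j \<in> J"
      using nth_mem[of _ ?s] by auto
    have "?s ! i = ?s ! j \<longleftrightarrow> i = j"
      using ij by (simp add: nth_eq_iff_index_eq)
    then show "Matrix.mat (card J) (card J) (\<lambda>(i, j). (chart_basis J X ! j) $ (?s ! i)) $$ (i, j)
        = 1\<^sub>m (card J) $$ (i, j)"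
      using ij m by (simp add: chart_basis_def chart_vector_nth[OF X] del: vector_add_component)
  qed auto
  then show ?thesis by (simp add: pluecker_def)
qed

section \<open>The torus action on Pluecker coordinates and on charts\<close>

text \<open>Each row of the minor is scaled by its entry of \<open>t\<close>, so all terms of the
  Leibniz expansion acquire the same product; \<open>card I = length bs\<close> makes the rows run
  through all of \<open>I\<close>.\<close>

lemma pluecker_torus:
  fixes t :: "complex ^ 'n::{finite,linorder}"
  assumes "card I = length bs"
  shows "pluecker (map ((*) t) bs) I = (\<Prod>i\<in>I. t $ i) * pluecker bs I"
proof -
  let ?s = "sorted_list_of_set I" and ?k = "length bs"
  have "bij_betw ((!) ?s) {..<?k} I"
    using assms by (intro bij_betw_nth) auto
  then have t: "(\<Prod>i = 0..<?k. t $ (?s ! i)) = (\<Prod>i\<in>I. t $ i)"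
    unfolding atLeast0LessThan by (rule prod.reindex_bij_betw)
  have "(\<Prod>i = 0..<?k. Matrix.mat ?k ?k (\<lambda>(i, j). (map ((*) t) bs ! j) $ (?s ! i)) $$ (i, p i)) =
    (\<Prod>i\<in>I. t $ i) * (\<Prod>i = 0..<?k. Matrix.mat ?k ?k (\<lambda>(i, j). (bs ! j) $ (?s ! i)) $$ (i, p i))"
    if "p permutes {0..<?k}" for p
    unfolding t[symmetric] prod.distrib[symmetric]
    by (rule prod.cong) (use permutes_in_image[OF that] in auto)
  then show ?thesis
    by (simp add: pluecker_def Determinant.det_def sum_distrib_left mult_ac cong: sum.cong_simp)
qed

lemma torus_linear: "Vector_Spaces.linear (*s) (*s) ((*) (t :: complex ^ 'n::finite))"
  by unfold_locales (auto simp: Finite_Cartesian_Product.vec_eq_iff algebra_simps)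

lemma inj_torus: "t \<in> carrier torus \<Longrightarrow> inj ((*) (t :: complex ^ 'n::finite))"
  by (auto simp: inj_def torus_def Finite_Cartesian_Product.vec_eq_iff)

lemma basis_list_torus:
  fixes t :: "complex ^ 'n::{finite,linorder}"
  assumes t: "t \<in> carrier torus" and bs: "basis_list L bs"
  shows "basis_list (torus_act t L) (map ((*) t) bs)"
proof -
  interpret t: Vector_Spaces.linear "(*s)" "(*s)" "(*) t" by (rule torus_linear)
  have inj: "inj_on ((*) t) A" for A
    using inj_torus[OF t] by (rule inj_on_subset) simp
  show ?thesis
    using bs t.independent_injective_image[of "set bs", OF _ inj] inj
    by (auto simp: basis_list_def torus_act_def distinct_map t.span_image)
qed

text \<open>The action of \<open>t\<close> in chart coordinates: row \<open>i\<close> is multiplied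
  by \<open>t $ i\<close>, and dividing column \<open>j\<close> by \<open>t $ j\<close> restores the
  identity in the rows \<open>J\<close>.\<close>

definition chart_torus :: "complex ^ 'n \<Rightarrow> complex ^ 'n ^ 'n \<Rightarrow> complex ^ 'n ^ 'n::finite" where
  "chart_torus t X = (\<chi> i j. t $ i * X $ i $ j / t $ j)"

lemma chart_torus_coords:
  "X \<in> chart_coords J \<Longrightarrow> chart_torus t X \<in> chart_coords J"
  by (auto simp: chart_torus_def chart_coords_def)

lemma torus_act_chart_param:
  fixes t :: "complex ^ 'n::finite"
  assumes t: "t \<in> carrier torus" and X: "X \<in> chart_coords J"
  shows "torus_act t (chart_param J X) = chart_param J (chart_torus t X)"
proof -
  have nz: "t $ i \<noteq> 0" for i using t by (simp add: torus_def)
  have *: "t * v \<in> chart_param J (chart_torus t X) \<longleftrightarrow> v \<in> chart_param J X" for v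
  proof -
    have "(\<Sum>l\<in>J. chart_torus t X $ i $ l * (t * v) $ l) = t $ i * (\<Sum>l\<in>J. X $ i $ l * v $ l)" for i
      unfolding sum_distrib_left by (rule sum.cong) (simp_all add: chart_torus_def nz)
    then show ?thesis
      unfolding mem_chart_param_iff[OF X] mem_chart_param_iff[OF chart_torus_coords[OF X]]
      by (simp add: nz)
  qed
  have "w \<in> torus_act t (chart_param J X)" if "w \<in> chart_param J (chart_torus t X)" for w
  proof -
    have "w = t * (\<chi> i. w $ i / t $ i)" using nz by (simp add: Finite_Cartesian_Product.vec_eq_iff)
    then show ?thesis using that * unfolding torus_act_def by (metis image_eqI)
  qed
  then show ?thesis using * by (auto simp: torus_act_def)
qed

section \<open>Pairings with the moment map and its invariance under the compact torus\<close>

lemma inner_indicator_vec: "inner (indicator_vec I) s = (\<Sum>i\<in>I. s $ i)"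
proof -
  have "inner (indicator_vec I) s = (\<Sum>i\<in>UNIV. if i \<in> I then s $ i else 0)"
    unfolding inner_vec_def indicator_vec_def by (rule sum.cong) auto
  then show ?thesis by (simp flip: sum.inter_restrict)
qed

lemma inner_moment_map_of_basis:
  "inner (moment_map_of_basis bs) s =
    (\<Sum>I | card I = length bs. (cmod (pluecker bs I))\<^sup>2 * (\<Sum>i\<in>I. s $ i)) /
    (\<Sum>I | card I = length bs. (cmod (pluecker bs I))\<^sup>2)"
  by (simp add: moment_map_of_basis_def inner_sum_left inner_indicator_vec)

text \<open>Every minor is multiplied by a number of modulus 1, so the weights do not
  change.\<close>

lemma moment_map_torus_unimodular:
  fixes t :: "complex ^ 'n::{finite,linorder}"
  assumes bs: "basis_list L bs" and t: "\<And>i. cmod (t $ i) = 1"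
  shows "moment_map (torus_act t L) = moment_map L"
proof -
  have "t \<in> carrier torus"
    using t unfolding torus_def by simp (metis norm_zero zero_neq_one)
  then have "basis_list (torus_act t L) (map ((*) t) bs)"
    using bs by (rule basis_list_torus)
  then have "moment_map (torus_act t L) = moment_map_of_basis (map ((*) t) bs)"
    by (rule moment_map_eq)
  also have "\<dots> = moment_map_of_basis bs"
  proof -
    have "cmod (pluecker (map ((*) t) bs) I) = cmod (pluecker bs I)" if "card I = length bs" for I
    proof -
      have "cmod (\<Prod>i\<in>I. t $ i) = 1" by (simp only: prod_norm[symmetric] t prod.neutral_const)
      then show ?thesis by (simp add: pluecker_torus[OF that] norm_mult)
    qed
    then show ?thesis unfolding moment_map_of_basis_def by (simp cong: sum.cong_simp)
  qed
  finally show ?thesis by (simp add: moment_map_eq[OF bs])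
qed

text \<open>The index set \<open>J\<close> alone contributes 1, so the denominator of the moment map
  is positive throughout the chart.\<close>

lemma pluecker_weight_pos:
  fixes X :: "complex ^ 'n::{finite,linorder} ^ 'n::{finite,linorder}"
  assumes X: "X \<in> chart_coords J"
  shows "(\<Sum>I | card I = card J. (cmod (pluecker (chart_basis J X) I))\<^sup>2) > 0"
  by (rule sum_pos2[of _ J]) (simp_all add: pluecker_chart_basis[OF X])

section \<open>Fixed points of torus elements in a chart\<close>

text \<open>Each basis vector of \<open>X\<close> satisfies the equations of \<open>Y\<close>; row
  \<open>i\<close> of these, for the vector with index \<open>j\<close>, reads
  \<open>X $ i $ j = Y $ i $ j\<close>.\<close>

lemma chart_param_inj:
  fixes X Y :: "complex ^ 'n ^ 'n::finite"
  assumes X: "X \<in> chart_coords J" and Y: "Y \<in> chart_coords J"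
    and eq: "chart_param J X = chart_param J Y"
  shows "X = Y"
proof -
  have "X $ i $ j = Y $ i $ j" for i j
  proof (cases "i \<notin> J \<and> j \<in> J")
    case True
    let ?b = "axis j 1 + (\<chi> i. X $ i $ j)"
    have "?b \<in> chart_param J X"
      unfolding chart_param_def using True by (intro vec.span_base) auto
    then have "?b \<in> chart_param J Y" by (simp only: eq)
    then have "?b $ i = (\<Sum>l\<in>J. Y $ i $ l * ?b $ l)"
      unfolding mem_chart_param_iff[OF Y] using True by blast
    also have "\<dots> = (\<Sum>l\<in>J. if l = j then Y $ i $ j else 0)"
      by (rule sum.cong) (use True in \<open>auto simp: chart_vector_nth[OF X] simp del: vector_add_component\<close>)
    also have "\<dots> = Y $ i $ j" using True by simp
    also have "?b $ i = X $ i $ j"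
      using True chart_vector_nth[OF X, of j i] by (simp only: simp_thms if_False)
    finally show ?thesis .
  next
    case False
    have "X $ i $ j = 0" using X False unfolding chart_coords_def by blast
    moreover have "Y $ i $ j = 0" using Y False unfolding chart_coords_def by blast
    ultimately show ?thesis by (rule trans[OF _ sym])
  qed
  then show ?thesis unfolding Finite_Cartesian_Product.vec_eq_iff by blast
qed

text \<open>Chart coordinates are unique, so fixing the subspace means fixing every entry under
  \<open>chart_torus\<close>. Stabilizers become conditions along the nonzero entries of
  \<open>X\<close>.\<close>

lemma torus_act_chart_param_eq_iff:
  fixes t :: "complex ^ 'n::finite"
  assumes t: "t \<in> carrier torus" and X: "X \<in> chart_coords J"
  shows "torus_act t (chart_param J X) = chart_param J X \<longleftrightarrow>
    (\<forall>i j. X $ i $ j \<noteq> 0 \<longrightarrow> t $ i = t $ j)"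
proof -
  have nz: "t $ i \<noteq> 0" for i using t by (simp add: torus_def)
  have "torus_act t (chart_param J X) = chart_param J X \<longleftrightarrow> chart_torus t X = X"
    unfolding torus_act_chart_param[OF t X]
    using chart_param_inj[OF chart_torus_coords[OF X] X] by metis
  also have "\<dots> \<longleftrightarrow> (\<forall>i j. t $ i * X $ i $ j / t $ j = X $ i $ j)"
    by (simp add: chart_torus_def Finite_Cartesian_Product.vec_eq_iff)
  also have "\<dots> \<longleftrightarrow> (\<forall>i j. X $ i $ j \<noteq> 0 \<longrightarrow> t $ i = t $ j)"
    using nz by (simp add: divide_eq_eq mult.commute) blast
  finally show ?thesis .
qed

section \<open>Real torus elements and the weighted mean along their flow\<close>

text \<open>These are the noncompact directions of the torus; the multiples of \<open>s\<close> form
  a one-parameter flow.\<close>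

definition exp_torus :: "real ^ 'n \<Rightarrow> complex ^ 'n::finite" where
  "exp_torus s = (\<chi> i. of_real (exp (s $ i)))"

lemma exp_torus_carrier: "exp_torus s \<in> carrier torus"
  by (simp add: exp_torus_def torus_def)

lemma prod_exp_torus: "(\<Prod>i\<in>I. exp_torus s $ i) = of_real (exp (\<Sum>i\<in>I. s $ i))"
  for I :: "'n::finite set"
  by (simp add: exp_torus_def exp_sum)

text \<open>Here \<open>exp_torus s\<close> fixes the subspace, so it multiplies all Pluecker
  coordinates by one scalar. Hence the sums of \<open>s\<close> over all \<open>I\<close> with
  nonzero coordinate agree, and their mean is the common value.\<close>

lemma inner_moment_map_chart_param:
  fixes X :: "complex ^ 'n::{finite,linorder} ^ 'n::{finite,linorder}"
  assumes X: "X \<in> chart_coords J" and s: "\<And>i j. X $ i $ j \<noteq> 0 \<Longrightarrow> s $ i = s $ j"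
  shows "inner (moment_map (chart_param J X)) s = (\<Sum>j\<in>J. s $ j)"
proof -
  let ?t = "exp_torus s" and ?bs = "chart_basis J X" and ?L = "chart_param J X"
  let ?w = "\<lambda>I. (cmod (pluecker ?bs I))\<^sup>2"
  note t = exp_torus_carrier[of s] and bs = basis_list_chart_basis[OF X]
  have "torus_act ?t ?L = ?L"
    unfolding torus_act_chart_param_eq_iff[OF t X] using s by (simp add: exp_torus_def)
  then have "basis_list ?L (map ((*) ?t) ?bs)"
    using basis_list_torus[OF t bs] by simp
  then obtain d where d: "\<And>I. pluecker (map ((*) ?t) ?bs) I = d * pluecker ?bs I"
    using pluecker_change_basis[OF bs] by blast
  have d': "of_real (exp (\<Sum>i\<in>I. s $ i)) * pluecker ?bs I = d * pluecker ?bs I" if "card I = card J" for I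
    using d[of I] pluecker_torus[of I ?bs ?t] that by (simp add: prod_exp_torus)
  \<comment> \<open>The coordinate at \<open>J\<close> is 1 and so reveals the scalar.\<close>
  have dJ: "d = of_real (exp (\<Sum>i\<in>J. s $ i))"
    using d'[of J] by (simp add: pluecker_chart_basis[OF X])
  have w: "?w I * (\<Sum>i\<in>I. s $ i) = ?w I * (\<Sum>j\<in>J. s $ j)" if "card I = card J" for I
  proof (cases "pluecker ?bs I = 0")
    case False
    then have "(of_real (exp (\<Sum>i\<in>I. s $ i)) :: complex) = of_real (exp (\<Sum>i\<in>J. s $ i))"
      using d'[OF that] dJ by simp
    then show ?thesis by (simp only: of_real_eq_iff exp_inj_iff)
  qed simp
  have "(\<Sum>I | card I = card J. ?w I * (\<Sum>i\<in>I. s $ i)) = (\<Sum>I | card I = card J. ?w I) * (\<Sum>j\<in>J. s $ j)"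
    unfolding sum_distrib_right by (rule sum.cong) (simp_all add: w)
  then show ?thesis
    using pluecker_weight_pos[OF X] by (simp add: moment_map_eq[OF bs] inner_moment_map_of_basis)
qed

lemma chart_entry_eq_0:
  fixes X :: "complex ^ 'n::{finite,linorder} ^ 'n::{finite,linorder}"
  assumes X: "X \<in> chart_coords J" and i: "i \<notin> J" and j: "j \<in> J"
    and 0: "pluecker (chart_basis J X) (insert i (J - {j})) = 0"
  shows "X $ i $ j = 0"
proof - \<comment> \<open>a combination of the basis vectors vanishing on the rows \<open>J - {j}\<close> is a multiple of the one with index \<open>j\<close>\<close>
  let ?I = "insert i (J - {j})" and ?k = "card J" and ?bs = "chart_basis J X"
  let ?s = "sorted_list_of_set ?I" and ?r = "sorted_list_of_set J"
  let ?A = "Matrix.mat ?k ?k (\<lambda>(a, p). (?bs ! p) $ (?s ! a))"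
  have cI: "card ?I = ?k"
    using i j by (metis card_Suc_Diff1 card_insert_disjoint Diff_iff finite)
  \<comment> \<open>The minor is \<open>X $ i $ j\<close> up to sign; a kernel vector avoids
    tracking that sign.\<close>
  have "Determinant.det ?A = 0" using 0 by (simp add: pluecker_def)
  then obtain v where v: "v \<in> carrier_vec ?k" "v \<noteq> 0\<^sub>v ?k" "?A *\<^sub>v v = 0\<^sub>v ?k"
    using det_0_iff_vec_prod_zero_field[of ?A ?k] by auto
  have row: "(\<Sum>p<?k. (?bs ! p) $ l * vec_index v p) = 0" if l: "l \<in> ?I" for l
  proof -
    obtain a where a: "a < ?k" "?s ! a = l"
      using l cI by (metis finite in_set_conv_nth length_sorted_list_of_set set_sorted_list_of_set)
    have "(\<Sum>p<?k. (?bs ! p) $ l * vec_index v p) = vec_index (?A *\<^sub>v v) a"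
      using a v(1) by (simp add: scalar_prod_def atLeast0LessThan)
    also have "\<dots> = vec_index (0\<^sub>v ?k) a" by (simp only: v(3))
    finally show ?thesis using a by simp
  qed
  have mem: "?r ! p \<in> J" if "p < ?k" for p
    using that by (metis finite length_sorted_list_of_set nth_mem set_sorted_list_of_set)
  have eq: "?r ! p = ?r ! q \<longleftrightarrow> p = q" if "p < ?k" "q < ?k" for p q
    using that by (simp add: nth_eq_iff_index_eq)
  have nth: "(?bs ! p) $ l = (if l \<in> J then if l = ?r ! p then 1 else 0 else X $ l $ (?r ! p))"
    if "p < ?k" for p l
    using that mem[OF that] by (simp add: chart_basis_def chart_vector_nth[OF X] del: vector_add_component)
  obtain q where q: "q < ?k" "?r ! q = j"
    using j by (metis finite in_set_conv_nth length_sorted_list_of_set set_sorted_list_of_set)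
  have z: "vec_index v p = 0" if p: "p < ?k" "p \<noteq> q" for p
  proof -
    have "?r ! p \<in> ?I" using p q eq[of p q] mem by auto
    then have "0 = (\<Sum>p'<?k. (?bs ! p') $ (?r ! p) * vec_index v p')" by (simp only: row)
    also have "\<dots> = (\<Sum>p'<?k. if p' = p then vec_index v p else 0)"
      by (rule sum.cong) (use p mem eq[OF p(1)] in \<open>auto simp: nth\<close>)
    finally show ?thesis using p by simp
  qed
  have "vec_index v q \<noteq> 0"
  proof
    assume "vec_index v q = 0"
    then have "v = 0\<^sub>v ?k" using v(1) z by (intro eq_vecI) auto
    then show False using v by simp
  qed
  \<comment> \<open>Only the coefficient at \<open>q\<close> survives, so the exchanged row
    \<open>i\<close> says that \<open>X $ i $ j\<close> times a nonzero number vanishes.\<close>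
  moreover have "0 = (\<Sum>p<?k. (?bs ! p) $ i * vec_index v p)" by (simp only: row insertI1)
  moreover have "\<dots> = (\<Sum>p<?k. if p = q then X $ i $ j * vec_index v q else 0)"
    by (rule sum.cong) (use i q z in \<open>auto simp: nth\<close>)
  ultimately show ?thesis using q by simp
qed

text \<open>The minor at \<open>I\<close> is scaled by \<open>exp (u * a I)\<close>, and squaring
  its modulus produces the 2. The result is the mean of \<open>a\<close> under exponentially tilted
  weights.\<close>

lemma inner_moment_map_flow:
  fixes X :: "complex ^ 'n::{finite,linorder} ^ 'n::{finite,linorder}" and s :: "real ^ 'n::{finite,linorder}"
  assumes X: "X \<in> chart_coords J"
  defines "w \<equiv> \<lambda>I. (cmod (pluecker (chart_basis J X) I))\<^sup>2" and "a \<equiv> \<lambda>I. \<Sum>i\<in>I. s $ i"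
  shows "inner (moment_map (chart_param J (chart_torus (exp_torus (u *\<^sub>R s)) X))) s =
    (\<Sum>I | card I = card J. w I * exp (2 * u * a I) * a I) / (\<Sum>I | card I = card J. w I * exp (2 * u * a I))"
proof -
  let ?t = "exp_torus (u *\<^sub>R s)" and ?bs = "chart_basis J X"
  have bs: "basis_list (chart_param J (chart_torus ?t X)) (map ((*) ?t) ?bs)"
    using basis_list_torus[OF exp_torus_carrier basis_list_chart_basis[OF X]]
    by (simp only: torus_act_chart_param[OF exp_torus_carrier X])
  have "(cmod (pluecker (map ((*) ?t) ?bs) I))\<^sup>2 = w I * exp (2 * u * a I)" if "card I = card J" for I
  proof -
    have "(\<Prod>i\<in>I. ?t $ i) = of_real (exp (u * a I))"
      unfolding prod_exp_torus a_def by (simp add: sum_distrib_left)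
    then have "cmod (pluecker (map ((*) ?t) ?bs) I) = exp (u * a I) * cmod (pluecker ?bs I)"
      using pluecker_torus[of I ?bs ?t] that by (simp add: norm_mult)
    moreover have "(exp (u * a I))\<^sup>2 = exp (2 * u * a I)"
      by (simp only: exp_double[symmetric] mult.assoc)
    ultimately show ?thesis by (simp only: w_def power_mult_distrib mult.commute)
  qed
  then show ?thesis
    unfolding moment_map_eq[OF bs] inner_moment_map_of_basis a_def by simp
qed

text \<open>The derivative is twice the variance of \<open>a\<close> under the weights \<open>w\<close>.\<close>

lemma weighted_mean_derivative_0:
  fixes w a :: "'a \<Rightarrow> real"
  assumes A: "finite A" and w: "\<And>x. x \<in> A \<Longrightarrow> w x \<ge> 0" and pos: "sum w A > 0"
    and der: "((\<lambda>u. (\<Sum>x\<in>A. w x * exp (2 * u * a x) * a x) / (\<Sum>x\<in>A. w x * exp (2 * u * a x)))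
      has_real_derivative 0) (at 0)"
    and x: "x \<in> A" "w x \<noteq> 0"
  shows "a x = (\<Sum>x\<in>A. w x * a x) / sum w A"
proof -
  \<comment> \<open>The moments of \<open>a\<close> under \<open>w\<close> of order 0, 1 and
    2.\<close>
  define W where "W = sum w A"
  define M where "M = (\<Sum>x\<in>A. w x * a x)"
  define V where "V = (\<Sum>x\<in>A. w x * (a x)\<^sup>2)"
  have n: "((\<lambda>u. \<Sum>x\<in>A. w x * exp (2 * u * a x) * a x) has_real_derivative 2 * V) (at 0)"
    unfolding V_def sum_distrib_left
    by (rule DERIV_sum) (auto intro!: derivative_eq_intros simp: power2_eq_square)
  have d: "((\<lambda>u. \<Sum>x\<in>A. w x * exp (2 * u * a x)) has_real_derivative 2 * M) (at 0)"
    unfolding M_def sum_distrib_left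
    by (rule DERIV_sum) (auto intro!: derivative_eq_intros)
  have "((\<lambda>u. (\<Sum>x\<in>A. w x * exp (2 * u * a x) * a x) / (\<Sum>x\<in>A. w x * exp (2 * u * a x)))
      has_real_derivative (2 * V * W - M * (2 * M)) / (W * W)) (at 0)"
    using DERIV_divide[OF n d] pos by (simp add: W_def M_def)
  then have "(2 * V * W - M * (2 * M)) / (W * W) = 0"
    using der by (rule DERIV_unique)
  then have V: "V * W = M * M" using pos by (simp add: W_def)
  \<comment> \<open>The equation \<open>V\<close> is the equality case of Cauchy-Schwarz: the sum of
    nonnegative terms below equals \<open>(V * W - M * M) / W\<close>, so each term
    vanishes.\<close>
  have "(\<Sum>x\<in>A. w x * (a x - M / W)\<^sup>2) = (\<Sum>x\<in>A. w x * (a x)\<^sup>2 - 2 * (M / W) * (w x * a x) + (M / W)\<^sup>2 * w x)"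
    by (rule sum.cong) (simp_all add: power2_eq_square algebra_simps)
  also have "\<dots> = V - 2 * (M / W) * M + (M / W)\<^sup>2 * W"
    by (simp only: sum.distrib sum_subtractf sum_distrib_left[symmetric] V_def W_def M_def)
  also have "\<dots> = (V * W - M * M) / W"
    using pos by (simp add: W_def field_simps power2_eq_square)
  finally have "(\<Sum>x\<in>A. w x * (a x - M / W)\<^sup>2) = 0" using V by simp
  then have "w x * (a x - M / W)\<^sup>2 = 0"
    using A w x(1) by (simp add: sum_nonneg_eq_0_iff)
  then show ?thesis using x(2) by (simp add: W_def M_def)
qed

section \<open>Differentiability of the moment map in a chart\<close>

lemma mem_chart_coords_iff:
  "X \<in> chart_coords J \<longleftrightarrow> (\<forall>i j. i \<in> J \<or> j \<notin> J \<longrightarrow> X $ i $ j = 0)"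
  unfolding chart_coords_def by blast

lemma subspace_chart_coords: "subspace (chart_coords J :: (complex ^ 'n::finite ^ 'n) set)"
  by (rule subspaceI) (simp_all add: mem_chart_coords_iff)

lemma differentiable_prod:
  fixes f :: "'i \<Rightarrow> 'a::real_normed_vector \<Rightarrow> 'b::real_normed_field"
  assumes "\<And>i. i \<in> A \<Longrightarrow> f i differentiable (at x within S)"
  shows "(\<lambda>x. \<Prod>i\<in>A. f i x) differentiable (at x within S)"
  using assms by (induction A rule: infinite_finite_induct) auto

text \<open>By the Leibniz formula the coordinate is a polynomial in the entries of
  \<open>Y\<close>.\<close>

lemma differentiable_pluecker_chart_basis:
  fixes X :: "complex ^ 'n::{finite,linorder} ^ 'n::{finite,linorder}"
  shows "(\<lambda>Y. pluecker (chart_basis J Y) I) differentiable (at X within S)"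
proof -
  let ?k = "card J" and ?s = "sorted_list_of_set I" and ?r = "sorted_list_of_set J"
  have lt: "p a < ?k" if "p permutes {0..<?k}" "a < ?k" for p a
    using permutes_in_image[OF that(1), of a] that(2) by simp
  have "pluecker (chart_basis J Y) I = (\<Sum>p | p permutes {0..<?k}. signof p *
      (\<Prod>a = 0..<?k. axis (?r ! p a) 1 $ (?s ! a) + Y $ (?s ! a) $ (?r ! p a)))"
    for Y :: "complex ^ 'n::{finite,linorder} ^ 'n::{finite,linorder}"
    unfolding pluecker_def Determinant.det_def
    by (auto simp: chart_basis_def lt intro!: sum.cong prod.cong)
  moreover have "(\<lambda>Y. Y $ i $ j) differentiable (at X within S)" for i j
    by (intro bounded_linear_imp_differentiable bounded_linear_compose[OF bounded_linear_vec_nth bounded_linear_vec_nth])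
  ultimately show ?thesis
    by (simp add: differentiable_prod finite_permutations)
qed

lemma differentiable_moment_map_chart_param:
  fixes X :: "complex ^ 'n::{finite,linorder} ^ 'n::{finite,linorder}"
  assumes X: "X \<in> chart_coords J"
  shows "(\<lambda>Y. moment_map (chart_param J Y)) differentiable (at X within chart_coords J)"
proof (rule differentiable_transform_within[where d = 1])
  \<comment> \<open>The squared modulus is a real inner product, differentiable even where the
    coordinate vanishes.\<close>
  have "(\<lambda>Y. (cmod (pluecker (chart_basis J Y) I))\<^sup>2) differentiable (at X within chart_coords J)" for I
    unfolding power2_norm_eq_inner
    by (intro differentiable_inner differentiable_pluecker_chart_basis)
  then show "(\<lambda>Y. moment_map_of_basis (chart_basis J Y)) differentiable (at X within chart_coords J)"
    unfolding moment_map_of_basis_def length_chart_basis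
    using pluecker_weight_pos[OF X] by (intro differentiable_scaleR differentiable_divide) auto
  \<comment> \<open>Off \<open>chart_coords J\<close> the chart basis need not be a basis, so the
    two functions are compared only within that subspace.\<close>
  show "moment_map_of_basis (chart_basis J Y) = moment_map (chart_param J Y)" if "Y \<in> chart_coords J" for Y
    using that by (rule moment_map_eq[symmetric, OF basis_list_chart_basis])
qed (use X in auto)

section \<open>Vectors orthogonal to the image of the differential\<close>

text \<open>The curve stays in \<open>C\<close>, so a derivative within \<open>C\<close> suffices
  for the chain rule.\<close>

lemma derivative_along_curve:
  assumes "(f has_derivative D) (at X within C)" "\<gamma> 0 = X" "\<And>u. \<gamma> u \<in> C"
    and "(\<gamma> has_vector_derivative H) (at (0::real))"
  shows "((\<lambda>u. f (\<gamma> u)) has_vector_derivative D H) (at 0)"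
  using vector_derivative_diff_chain_within[of \<gamma> H 0 UNIV f D] assms
  by (auto simp: o_def intro: has_derivative_subset)

lemma chart_torus_flow_derivative:
  fixes X :: "complex ^ 'n::finite ^ 'n"
  shows "((\<lambda>u. chart_torus (exp_torus (u *\<^sub>R s)) X) has_vector_derivative
    (\<chi> i j. (s $ i - s $ j) *\<^sub>R X $ i $ j)) (at 0)"
proof -
  \<comment> \<open>A sum over single-entry matrices lets the derivative be taken term by
    term.\<close>
  have expand: "(\<chi> i j. c i j *\<^sub>R X $ i $ j) = (\<Sum>i\<in>UNIV. \<Sum>j\<in>UNIV. c i j *\<^sub>R axis i (axis j (X $ i $ j)))" for c
  proof -
    have "c i j *\<^sub>R axis i (axis j (X $ i $ j)) $ a $ b =
        (if j = b then if i = a then c a b *\<^sub>R X $ a $ b else 0 else 0)" for i j a b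
      by (auto simp: axis_def)
    then have "(\<Sum>i\<in>UNIV. \<Sum>j\<in>UNIV. c i j *\<^sub>R axis i (axis j (X $ i $ j))) $ a $ b = c a b *\<^sub>R X $ a $ b" for a b
      unfolding sum_component vector_scaleR_component by simp
    then show ?thesis by (simp add: Finite_Cartesian_Product.vec_eq_iff)
  qed
  have "chart_torus (exp_torus (u *\<^sub>R s)) X = (\<chi> i j. exp (u * (s $ i - s $ j)) *\<^sub>R X $ i $ j)" for u
    by (simp add: chart_torus_def exp_torus_def Finite_Cartesian_Product.vec_eq_iff
        scaleR_conv_of_real[where 'a = complex] right_diff_distrib exp_diff)
  then show ?thesis
    unfolding expand by (auto intro!: derivative_eq_intros)
qed

text \<open>The differential is tested on the direction generated by \<open>s\<close> itself: zero
  variance makes the sums of \<open>s\<close> agree on all index sets with nonzero coordinate. A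
  nonzero \<open>X $ i $ j\<close> puts both \<open>J\<close> and its exchange
  \<open>insert i (J - {j})\<close> among these, and their sums differ by
  \<open>s $ i - s $ j\<close>.\<close>

lemma orthogonal_derivative_imp_block:
  fixes X :: "complex ^ 'n::{finite,linorder} ^ 'n::{finite,linorder}" and s :: "real ^ 'n::{finite,linorder}"
  assumes X: "X \<in> chart_coords J"
    and der: "((\<lambda>Y. moment_map (chart_param J Y)) has_derivative D) (at X within chart_coords J)"
    and orth: "\<And>H. H \<in> chart_coords J \<Longrightarrow> inner (D H) s = 0"
    and ij: "X $ i $ j \<noteq> 0"
  shows "s $ i = s $ j"
proof -
  define w where "w I = (cmod (pluecker (chart_basis J X) I))\<^sup>2" for I
  define a where "a I = (\<Sum>i\<in>I. s $ i)" for I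
  \<comment> \<open>\<open>?H\<close> is the velocity at time 0 of the flow of \<open>s\<close>
    through \<open>X\<close>.\<close>
  let ?H = "\<chi> i j. (s $ i - s $ j) *\<^sub>R X $ i $ j" and ?A = "{I :: 'n set. card I = card J}"
  have H: "?H \<in> chart_coords J" using X by (auto simp: chart_coords_def)
  have "((\<lambda>u. moment_map (chart_param J (chart_torus (exp_torus (u *\<^sub>R s)) X))) has_vector_derivative D ?H) (at 0)"
    by (rule derivative_along_curve[OF der _ _ chart_torus_flow_derivative])
      (simp_all add: chart_torus_coords X, simp add: chart_torus_def exp_torus_def Finite_Cartesian_Product.vec_eq_iff)
  then have "((\<lambda>u. inner (moment_map (chart_param J (chart_torus (exp_torus (u *\<^sub>R s)) X))) s)
      has_real_derivative 0) (at 0)"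
    unfolding has_real_derivative_iff_has_vector_derivative orth[OF H, symmetric]
    by (rule bounded_linear.has_vector_derivative[OF bounded_linear_inner_left])
  then have der0: "((\<lambda>u. (\<Sum>I\<in>?A. w I * exp (2 * u * a I) * a I) / (\<Sum>I\<in>?A. w I * exp (2 * u * a I)))
      has_real_derivative 0) (at 0)"
    by (simp only: inner_moment_map_flow[OF X] w_def a_def)
  have mean: "a I = (\<Sum>I\<in>?A. w I * a I) / sum w ?A" if "card I = card J" "pluecker (chart_basis J X) I \<noteq> 0" for I
    by (rule weighted_mean_derivative_0[OF _ _ _ der0])
      (use that pluecker_weight_pos[OF X] in \<open>auto simp: w_def\<close>)
  have mem: "i \<notin> J" "j \<in> J" using X ij by (auto simp: chart_coords_def)
  let ?I = "insert i (J - {j})"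
  have "card ?I = card J"
    using mem by (metis card_Suc_Diff1 card_insert_disjoint Diff_iff finite)
  moreover have "pluecker (chart_basis J X) ?I \<noteq> 0"
    using chart_entry_eq_0[OF X mem] ij by blast
  ultimately have "a ?I = a J"
    using mean[of ?I] mean[of J] pluecker_chart_basis[OF X] by simp
  moreover have "a ?I = s $ i + a (J - {j})" using mem by (simp add: a_def)
  moreover have "a J = s $ j + a (J - {j})" using mem by (simp add: a_def sum.remove)
  ultimately show ?thesis by simp
qed

lemma has_vector_derivative_line: "((\<lambda>u. X + u *\<^sub>R H) has_vector_derivative H) (at u)"
  by (auto intro!: derivative_eq_intros)

text \<open>The condition on \<open>S\<close> says that no nonzero entry of \<open>X\<close> links
  \<open>S\<close> to its complement. Level sets of a torus element fixing the subspace qualify, and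
  so does \<open>UNIV\<close>, which places the image in the hyperplane of coordinate sum 0.\<close>

lemma block_imp_orthogonal_derivative:
  fixes X :: "complex ^ 'n::{finite,linorder} ^ 'n::{finite,linorder}"
  assumes X: "X \<in> chart_coords J"
    and der: "((\<lambda>Y. moment_map (chart_param J Y)) has_derivative D) (at X within chart_coords J)"
    and S: "\<And>i j. X $ i $ j \<noteq> 0 \<Longrightarrow> i \<in> S \<longleftrightarrow> j \<in> S"
    and H: "H \<in> chart_coords J"
  shows "inner (D H) (indicator_vec S) = 0"
proof -
  let ?f = "\<lambda>Y. moment_map (chart_param J Y)"
  \<comment> \<open>\<open>H1\<close> collects the entries within \<open>S\<close> and within its
    complement, \<open>H2\<close> those across.\<close>
  define H1 where "H1 = (\<chi> i j. if i \<in> S \<longleftrightarrow> j \<in> S then H $ i $ j else 0)"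
  define H2 where "H2 = (\<chi> i j. if i \<in> S \<longleftrightarrow> j \<in> S then 0 else H $ i $ j)"
  have line: "X + u *\<^sub>R K \<in> chart_coords J" if "K \<in> chart_coords J" for u K
    using X that by (simp add: mem_chart_coords_iff)
  have der_line: "((\<lambda>u. ?f (X + u *\<^sub>R K)) has_vector_derivative D K) (at 0)" if "K \<in> chart_coords J" for K
    by (rule derivative_along_curve[OF der _ _ has_vector_derivative_line]) (simp_all add: line that)
  have H1: "H1 \<in> chart_coords J" and H2: "H2 \<in> chart_coords J" and H2': "- H2 \<in> chart_coords J"
    using H by (auto simp: chart_coords_def H1_def H2_def)
  have "inner (D H1) (indicator_vec S) = 0"
  proof -
    \<comment> \<open>Moving along \<open>H1\<close> creates no entry across \<open>S\<close>, so
      the pairing stays constant.\<close>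
    have "inner (?f (X + u *\<^sub>R H1)) (indicator_vec S) = (\<Sum>j\<in>J. indicator_vec S $ j)" for u
    proof (rule inner_moment_map_chart_param[OF line[OF H1]])
      fix i j assume "(X + u *\<^sub>R H1) $ i $ j \<noteq> 0"
      then have "X $ i $ j \<noteq> 0 \<or> H1 $ i $ j \<noteq> 0" by auto
      then have "i \<in> S \<longleftrightarrow> j \<in> S" using S by (auto simp: H1_def split: if_splits)
      then show "indicator_vec S $ i = indicator_vec S $ j" by (simp add: indicator_vec_def)
    qed
    then have "((\<lambda>u. inner (?f (X + u *\<^sub>R H1)) (indicator_vec S)) has_vector_derivative 0) (at 0)"
      by simp
    then show ?thesis
      using bounded_linear.has_vector_derivative[OF bounded_linear_inner_left der_line[OF H1]]
      by (rule vector_derivative_unique_at[symmetric])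
  qed
  moreover have "D H2 = 0" \<comment> \<open>the torus element that is \<open>-1\<close> on \<open>S\<close> and \<open>1\<close> off \<open>S\<close> preserves the moment map, fixes \<open>X\<close> and negates \<open>H2\<close>\<close>
  proof -
    define t :: "complex ^ 'n::{finite,linorder}" where "t = (\<chi> i. if i \<in> S then - 1 else 1)"
    have t: "cmod (t $ i) = 1" for i by (simp add: t_def)
    have carr: "t \<in> carrier torus" by (simp add: t_def torus_def)
    have flip: "chart_torus t (X + u *\<^sub>R H2) = X + u *\<^sub>R (- H2)" for u
    proof -
      have "chart_torus t (X + u *\<^sub>R H2) $ i $ j = (X + u *\<^sub>R (- H2)) $ i $ j" for i j
        using S[of i j] by (cases "X $ i $ j = 0") (auto simp: chart_torus_def t_def H2_def)
      then show ?thesis by (simp only: Finite_Cartesian_Product.vec_eq_iff) blast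
    qed
    have "?f (X + u *\<^sub>R (- H2)) = ?f (X + u *\<^sub>R H2)" for u
      using moment_map_torus_unimodular[OF basis_list_chart_basis[OF line[OF H2]] t, of u]
      unfolding torus_act_chart_param[OF carr line[OF H2]] flip .
    then have "D (- H2) = D H2"
      using vector_derivative_unique_at[OF der_line[OF H2'] _] der_line[OF H2] by simp
    then have "- D H2 = D H2"
      using linear_neg[OF has_derivative_linear[OF der]] by simp
    then show ?thesis by (metis add.right_inverse scaleR_2 scaleR_eq_0_iff zero_neq_numeral)
  qed
  moreover have "D H = D H1 + D H2"
  proof -
    have "H = H1 + H2" by (simp add: H1_def H2_def Finite_Cartesian_Product.vec_eq_iff)
    then show ?thesis using linear_add[OF has_derivative_linear[OF der]] by simp
  qed
  ultimately show ?thesis by (simp add: inner_add_left)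
qed

section \<open>Codimension one in terms of orthogonal vectors\<close>

text \<open>The orthogonal complement of \<open>V\<close> contains the line of constant vectors, and
  the two dimensions add up to \<open>CARD('n)\<close>. So \<open>V\<close> has codimension one
  exactly when its complement is no larger than that line.\<close>

lemma codimension_one_iff:
  fixes V :: "(real ^ 'n::finite) set"
  assumes V: "subspace V" and one: "\<And>v. v \<in> V \<Longrightarrow> inner v (indicator_vec UNIV) = 0"
  shows "dim V = CARD('n) - 1 \<longleftrightarrow> (\<forall>s. (\<forall>v\<in>V. inner v s = 0) \<longrightarrow> (\<forall>i j. s $ i = s $ j))"
proof -
  define W where "W = {s. \<forall>v\<in>V. inner v s = 0}"
  let ?one = "indicator_vec UNIV :: real ^ 'n"
  have dim: "dim W + dim V = CARD('n)"
    using dim_subspace_orthogonal_to_vectors[OF V subspace_UNIV subset_UNIV]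
    by (simp add: W_def real_inner_class.orthogonal_def)
  have W: "subspace W"
    by (rule subspaceI) (auto simp: W_def inner_add_right)
  have oneW: "?one \<in> W" using one by (auto simp: W_def)
  then have sub: "span {?one} \<subseteq> W" using W by (simp add: span_minimal)
  have "?one \<noteq> 0" by (auto simp: indicator_vec_def Finite_Cartesian_Product.vec_eq_iff)
  then have d1: "dim (span {?one}) = 1" by (simp add: dim_insert)
  have "dim V = CARD('n) - 1 \<longleftrightarrow> dim W = 1"
    using dim d1 dim_subset[OF sub] by linarith
  also have "\<dots> \<longleftrightarrow> W \<subseteq> span {?one}"
  proof
    assume "dim W = 1"
    then have "span {?one} = W"
      using d1 by (intro subspace_dim_equal[OF subspace_span W sub]) linarith
    then show "W \<subseteq> span {?one}" by (rule equalityD2)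
  next
    assume "W \<subseteq> span {?one}"
    then show "dim W = 1" using dim_subset dim_subset[OF sub] d1 by (metis order_antisym)
  qed
  also have "\<dots> \<longleftrightarrow> (\<forall>s\<in>W. \<forall>i j. s $ i = s $ j)"
  proof -
    have "s \<in> span {?one} \<longleftrightarrow> (\<forall>i j. s $ i = s $ j)" for s
      by (auto simp: span_singleton indicator_vec_def Finite_Cartesian_Product.vec_eq_iff
          intro!: range_eqI[of _ _ "s $ undefined"])
    then show ?thesis by blast
  qed
  finally show ?thesis by (simp add: W_def)
qed

section \<open>Every subspace lies in some chart\<close>

text \<open>A basis of \<open>L\<close> is completed by standard basis vectors, with index set
  \<open>K\<close>. They span a complement of \<open>L\<close>, so the coordinates outside
  \<open>K\<close> serve as \<open>J\<close>.\<close>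

lemma chart_exists:
  fixes L :: "(complex ^ 'n::{finite,linorder}) set"
  assumes "L \<in> grassmannian k"
  obtains J X where "card J = k" "X \<in> chart_coords J" "chart_param J X = L"
proof -
  have sub: "vec.subspace L" and dimL: "vec.dim L = k" using assms by (auto simp: grassmannian_def)
  obtain B where B: "B \<subseteq> L" "vec.independent B" "L \<subseteq> vec.span B" "card B = k"
    using vec.basis_exists[of L] dimL by metis
  have spanB: "vec.span B = L" using B(1,3) sub by (rule vec.span_subspace)
  obtain M where M: "B \<subseteq> M" "M \<subseteq> B \<union> cart_basis" "vec.independent M" "B \<union> cart_basis \<subseteq> vec.span M"
    using vec.maximal_independent_subset_extend[of B "B \<union> cart_basis"] B(2) by blast
  have spanM: "vec.span M = UNIV"
  proof -
    have "vec.span cart_basis \<subseteq> vec.span M"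
      using M(4) by (intro vec.span_minimal vec.subspace_span) blast
    then show ?thesis unfolding span_cart_basis by blast
  qed
  have finM: "finite M" using M(3) by (rule vec.finiteI_independent)
  have cardM: "card M = CARD('n)"
    using vec.dim_eq_card_independent[OF M(3)] vec.dim_span[of M] by (simp add: spanM vec_dim_card card_cart_basis)
  define T where "T = M - B"
  define K where "K = {i :: 'n. axis i 1 \<in> T}"
  have T: "T = (\<lambda>i. axis i 1) ` K" using M(2) by (auto simp: T_def K_def cart_basis_def)
  then have "card T = card K"
    by (simp add: card_image inj_on_def axis_eq_axis)
  then have "card K = CARD('n) - k"
    using finM M(1) B(4) cardM by (simp add: T_def card_Diff_subset finite_subset)
  moreover have "k \<le> CARD('n)" using card_mono[OF finM M(1)] B(4) cardM by simp
  ultimately have cardJ: "card (- K) = k" by (simp add: Compl_eq_Diff_UNIV card_Diff_subset)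
  have T0: "w $ i = 0" if "w \<in> vec.span T" "i \<notin> K" for w i
  proof -
    have "vec.subspace {w :: complex ^ 'n::{finite,linorder}. w $ i = 0}" by (auto simp: vec.subspace_def)
    moreover have "T \<subseteq> {w. w $ i = 0}"
      using T that(2) by (auto simp: axis_def)
    ultimately show ?thesis using vec.span_minimal that(1) by blast
  qed
  \<comment> \<open>Since \<open>L\<close> and \<open>T\<close> together span everything, each unit
    vector can be corrected by a vector supported on \<open>K\<close> so as to land in
    \<open>L\<close>. The negated corrections become the chart entries.\<close>
  have "\<exists>w. w \<in> vec.span T \<and> axis j 1 - w \<in> L" for j
  proof -
    have "axis j 1 \<in> vec.span (B \<union> T)"
      using spanM M(1) by (simp add: T_def Un_absorb1)
    then show ?thesis unfolding vec.span_Un spanB by auto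
  qed
  then obtain w where w: "\<And>j. w j \<in> vec.span T" "\<And>j. axis j 1 - w j \<in> L" by metis
  define X where "X = (\<chi> i j. if i \<in> K \<and> j \<notin> K then - w j $ i else 0)"
  have X: "X \<in> chart_coords (- K)" by (auto simp: X_def chart_coords_def)
  have "axis j 1 + (\<chi> i. X $ i $ j) = axis j 1 - w j" if "j \<notin> K" for j
    using that T0[OF w(1)] by (auto simp: X_def Finite_Cartesian_Product.vec_eq_iff)
  \<comment> \<open>One inclusion is enough, because both subspaces have dimension
    \<open>k\<close>.\<close>
  then have "chart_param (- K) X \<subseteq> L"
    unfolding chart_param_def by (intro vec.span_minimal sub) (auto simp: w)
  moreover have bl: "basis_list (chart_param (- K) X) (chart_basis (- K) X)"
    using X by (rule basis_list_chart_basis)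
  then have "vec.dim (chart_param (- K) X) = k"
    using vec.dim_span[of "set (chart_basis (- K) X)"] vec.dim_eq_card_independent[of "set (chart_basis (- K) X)"]
      distinct_card[of "chart_basis (- K) X"]
    by (simp add: basis_list_def cardJ)
  ultimately have "chart_param (- K) X = L"
    using sub dimL by (intro vec.subspace_dim_equal) (auto simp: chart_param_def)
  then show ?thesis using that cardJ X by blast
qed

section \<open>Stabilizers in the quotient torus\<close>

text \<open>A coset acts through any representative, so the stabilizer in the quotient is the image
  of the stabilizer in \<open>torus\<close>, and the coset \<open>diagonal\<close> is the
  identity.\<close>

lemma stabilizer_trivial_iff:
  fixes L :: "(complex ^ 'n::finite) set"
  assumes L: "L \<in> grassmannian k"
  shows "stabilizer effective_torus (effective_act k) L = {\<one>\<^bsub>effective_torus\<^esub>} \<longleftrightarrow>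
    (\<forall>t\<in>carrier torus. torus_act t L = L \<longrightarrow> t \<in> diagonal)"
proof -
  interpret T: comm_group "torus :: (complex ^ 'n) monoid" by (rule comm_group_torus)
  interpret D: normal diagonal "torus :: (complex ^ 'n) monoid" by (rule diagonal_normal)
  have sub: "subgroup diagonal (torus :: (complex ^ 'n) monoid)" by (rule D.subgroup_axioms)
  let ?A = "{t \<in> carrier torus. torus_act t L = L}" and ?f = "\<lambda>t. diagonal #>\<^bsub>torus\<^esub> t"
  have "stabilizer effective_torus (effective_act k) L = {C \<in> ?f ` carrier torus. effective_act k C L = L}"
    unfolding stabilizer_def carrier_FactGroup ..
  also have "\<dots> = ?f ` {t \<in> carrier torus. effective_act k (?f t) L = L}" by blast
  also have "\<dots> = ?f ` ?A" by (simp only: effective_act_coset[OF L])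
  finally have stab: "stabilizer effective_torus (effective_act k) L = ?f ` ?A" .
  have eq: "?f t = diagonal \<longleftrightarrow> t \<in> diagonal" if "t \<in> carrier torus" for t :: "complex ^ 'n"
  proof
    show "?f t = diagonal \<Longrightarrow> t \<in> diagonal" by (rule T.coset_join1[OF _ that sub])
    show "t \<in> diagonal \<Longrightarrow> ?f t = diagonal" by (rule T.coset_join2[OF that sub])
  qed
  have "1 \<in> ?A" by (simp add: torus_def torus_act_one)
  then have "?f ` ?A = {diagonal} \<longleftrightarrow> (\<forall>t\<in>?A. ?f t = diagonal)" by blast
  also have "\<dots> \<longleftrightarrow> (\<forall>t\<in>?A. t \<in> diagonal)" using eq by (intro ball_cong) simp_all
  finally show ?thesis unfolding stab one_FactGroup by (simp add: Ball_def imp_conjL)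
qed

theorem corollary3p10:
  fixes k :: nat and L :: "(complex ^ 'n::{finite,linorder}) set"
  assumes "1 \<le> k" and "k \<le> CARD('n) - 1"
    and "L \<in> grassmannian k"
  shows "regular_point k L \<longleftrightarrow>
    stabilizer effective_torus (effective_act k) L = {\<one>\<^bsub>effective_torus\<^esub>}"
proof -
  \<comment> \<open>The equivalence is shown for every chart around \<open>L\<close> and every
    derivative there, since \<open>has_differential_rank\<close> asserts only that some such data
    exist.\<close>
  have rank: "dim (D ` chart_coords J) = CARD('n) - 1 \<longleftrightarrow>
      (\<forall>t\<in>carrier torus. torus_act t L = L \<longrightarrow> t \<in> diagonal)"
    if X: "X \<in> chart_coords J" and L: "chart_param J X = L"
      and der: "((\<lambda>Y. moment_map (chart_param J Y)) has_derivative D) (at X within chart_coords J)"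
    for J D and X :: "complex ^ 'n::{finite,linorder} ^ 'n::{finite,linorder}"
  proof -
    have sub: "subspace (D ` chart_coords J)"
      using linear_subspace_image[OF has_derivative_linear[OF der] subspace_chart_coords] .
    have "dim (D ` chart_coords J) = CARD('n) - 1 \<longleftrightarrow>
        (\<forall>s. (\<forall>v\<in>D ` chart_coords J. inner v s = 0) \<longrightarrow> (\<forall>i j. s $ i = s $ j))"
      by (rule codimension_one_iff[OF sub]) (auto intro: block_imp_orthogonal_derivative[OF X der])
    also have "\<dots> \<longleftrightarrow> (\<forall>t\<in>carrier torus. torus_act t L = L \<longrightarrow> t \<in> diagonal)"
    proof safe
      fix t :: "complex ^ 'n::{finite,linorder}"
      assume const: "\<forall>s. (\<forall>v\<in>D ` chart_coords J. inner v s = 0) \<longrightarrow> (\<forall>i j. s $ i = s $ j)"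
        and t: "t \<in> carrier torus" and fix_L: "torus_act t L = L"
      have block: "t $ i = t $ j" if "X $ i $ j \<noteq> 0" for i j
        using fix_L that torus_act_chart_param_eq_iff[OF t X] L by blast
      have eq: "t $ i = t $ j" for i j
      proof -
        \<comment> \<open>By \<open>block\<close>, the level set of \<open>t\<close> through
          \<open>j\<close> is linked to its complement by no nonzero entry of
          \<open>X\<close>.\<close>
        let ?s = "indicator_vec {l. t $ l = t $ j}"
        have "inner (D H) ?s = 0" if "H \<in> chart_coords J" for H
          by (rule block_imp_orthogonal_derivative[OF X der _ that]) (auto dest: block)
        then have "?s $ i = ?s $ j" using const by blast
        then show ?thesis by (simp add: indicator_vec_def split: if_splits)
      qed
      define c where "c = t $ undefined"
      have "t = (\<chi> i. c)" using eq by (simp add: c_def Finite_Cartesian_Product.vec_eq_iff)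
      moreover have "c \<noteq> 0" using t by (simp add: c_def torus_def)
      ultimately show "t \<in> diagonal" by (auto simp: diagonal_def)
    next
      fix s :: "real ^ 'n::{finite,linorder}" and i j
      assume diag: "\<forall>t\<in>carrier torus. torus_act t L = L \<longrightarrow> t \<in> diagonal"
        and orth: "\<forall>v\<in>D ` chart_coords J. inner v s = 0"
      \<comment> \<open>Equality along nonzero entries makes \<open>exp_torus s\<close> fix
        \<open>L\<close>; being diagonal then forces equality for all pairs.\<close>
      have "s $ i = s $ j" if "X $ i $ j \<noteq> 0" for i j
        by (rule orthogonal_derivative_imp_block[OF X der _ that]) (use orth in blast)
      then have "torus_act (exp_torus s) L = L"
        using torus_act_chart_param_eq_iff[OF exp_torus_carrier X] L by (simp add: exp_torus_def)
      then have "exp_torus s \<in> diagonal" using diag exp_torus_carrier by blast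
      then have "exp_torus s $ i = exp_torus s $ j" by (auto simp: diagonal_def)
      then show "s $ i = s $ j" by (simp add: exp_torus_def)
    qed
    finally show ?thesis .
  qed
  \<comment> \<open>A chart and a derivative must be exhibited to pass from a trivial stabilizer to
    regularity.\<close>
  obtain J X where J: "card J = k" and X: "X \<in> chart_coords J" and L: "chart_param J X = L"
    using chart_exists[OF assms(3)] by blast
  obtain D where D: "((\<lambda>Y. moment_map (chart_param J Y)) has_derivative D) (at X within chart_coords J)"
    using differentiable_moment_map_chart_param[OF X] by (auto simp: differentiable_def)
  show ?thesis
    unfolding stabilizer_trivial_iff[OF assms(3)] regular_point_def has_differential_rank_def
    using rank J X L D by blast
qed

end
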